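(* For all $n\ge1$: (a) $G^{\mathrm{I}}_{2n,1}=G^{\mathrm{I}}_{2n,2}$; (b) $2G^{\mathrm{I}}_{2n,2n-1}=\sum_{i=1}^{2n}G^{\mathrm{I}}_{2n,i}$; (c) $G^{\mathrm{I}}_{2n,2k}=S_{2n,n+1-k}$ for every $1\le k\le n$. Moreover, for all $n\ge2$: (d) $G^{\mathrm{I}}_{2n,3}=2\left(G^{\mathrm{I}}_{2n,1}+G^{\mathrm{I}}_{2n-2,1}\right)$; (e) $G^{\mathrm{I}}_{2n,2n}=\sum_{i=1}^{2n-2}G^{\mathrm{I}}_{2n-2,i}=G^{\mathrm{I}}_{2n-2}$.
   Context: For $n\ge1$, $\mathfrak{G}^{\mathrm{I}}_{2n}$ is the set of permutations $\pi=\pi_1\cdots\pi_{2n}$ of $[2n]$ such that every ascent $\pi_i<\pi_{i+1}$ has $\pi_i$ odd and $\pi_{i+1}$ even. Let $G^{\mathrm{I}}_{2n}=|\mathfrak{G}^{\mathrm{I}}_{2n}|$, and for $1\le k\le 2n$ let $G^{\mathrm{I}}_{2n,k}$ be the number of $\pi\in\mathfrak{G}^{\mathrm{I}}_{2n}$ with $\pi_1=k$; set $G^{\mathrm{I}}_{2n,k}=0$ for $k<1$ or $k>2n$. The Seidel triangle $(S_{n,k})$ is defined by $S_{1,1}=1$, $S_{n,k}=0$ if $k\notin[1,\lceil n/2\rceil]$, and for $n\ge1$: $S_{2n,k}=S_{2n-1,k}+S_{2n,k+1}$ and $S_{2n+1,k}=S_{2n,k}+S_{2n+1,k-1}$. 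*)

theory Defs
  imports Main "HOL-Combinatorics.Multiset_Permutations"
begin

text \<open>Permutations of \<open>[m]\<close> are lists in one-line notation. The argument \<open>m\<close> is
  the full subscript, so the sets of interest are those with \<open>m = 2 * n\<close>.\<close>

definition perms_I :: "nat \<Rightarrow> nat list set" where
  "perms_I m = {\<pi> \<in> permutations_of_set {1..m}.
     \<forall>i. Suc i < length \<pi> \<longrightarrow> \<pi> ! i < \<pi> ! Suc i \<longrightarrow> odd (\<pi> ! i) \<and> even (\<pi> ! Suc i)}"

definition G_I :: "nat \<Rightarrow> nat" where
  "G_I m = card (perms_I m)"

definition G_I_first :: "nat \<Rightarrow> nat \<Rightarrow> nat" where
  "G_I_first m k = (if 1 \<le> k \<and> k \<le> m then card {\<pi> \<in> perms_I m. hd \<pi> = k} else 0)"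

text \<open>The Seidel triangle. The vanishing condition outside \<open>1 \<le> k \<le> \<lceil>m/2\<rceil>\<close> takes
  precedence over the recurrences, which apply only inside that range (read for all \<open>k\<close>,
  they would contradict it, e.g. at \<open>S\<^sub>2\<^sub>,\<^sub>0\<close>). Row \<open>0\<close>, which is not part of the triangle,
  is identically zero. Note that \<open>\<lceil>m/2\<rceil> = (m + 1) div 2\<close>.\<close>

function seidel :: "nat \<Rightarrow> nat \<Rightarrow> nat" where
  "seidel m k =
     (if k < 1 \<or> (m + 1) div 2 < k then 0
      else if m = 1 then 1
      else if even m then seidel (m - 1) k + seidel m (k + 1)
      else seidel (m - 1) k + seidel m (k - 1))"
  by pat_completeness auto
termination
  by (relation "measures [fst, \<lambda>(m, k). if even m then (m + 1) div 2 + 1 - k else k]") auto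

declare seidel.simps [simp del]

end

theory Submission
  imports Defs
begin

text \<open>
  An even letter must be followed by a smaller one (or end the word), an odd letter must be
  preceded by a larger one (or start the word). All parts come from deleting or relabelling
  extreme letters: 1 is last or followed by an even letter, 2 is last or followed by 1, and \<open>2n - 1\<close> is
  first or preceded by \<open>2n\<close>.

  Part (c) reduces to \<open>G(2n, 2k) = G(2n, 2k - 2) + (\<Sum>j \<ge> k - 1. G(2n - 2, 2j))\<close>, where \<open>G(m, j)\<close>
  counts the permutations of \<open>[m]\<close> with first letter \<open>j\<close> and \<open>G(2n, 0) = 0\<close>. Put \<open>v = 2k - 2\<close>.
  Removing the first letter leaves words on \<open>v, v + 1\<close> respectively \<open>v + 1, v + 2\<close> together with
  the other letters; renaming \<open>v\<close> to \<open>v + 2\<close> misses exactly the words with the factor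
  \<open>v + 2, v + 1\<close>. These are counted by comparing the insertions of the factor and of a single letter
  into words that start below \<open>v\<close>, where crossings of the level \<open>v\<close> upwards and downwards balance.
\<close>

section \<open>Words over a finite alphabet and their relabellings\<close>

definition asc_ok :: "nat \<Rightarrow> nat \<Rightarrow> bool" where
  "asc_ok a b \<longleftrightarrow> (a < b \<longrightarrow> odd a \<and> even b)"

text \<open>The empty word belongs to \<open>words R {} J\<close> for every \<open>J\<close>, so that prepending a letter also works
  for one-letter words.\<close>

definition words :: "('a \<Rightarrow> 'a \<Rightarrow> bool) \<Rightarrow> 'a set \<Rightarrow> 'a set \<Rightarrow> 'a list set" where
  "words R A J = {xs. distinct xs \<and> set xs = A \<and> successively R xs \<and> (xs = [] \<or> hd xs \<in> J)}"

abbreviation num_words :: "nat set \<Rightarrow> nat set \<Rightarrow> nat" where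
  "num_words A J \<equiv> card (words asc_ok A J)"

lemma finite_words [simp]: "finite A \<Longrightarrow> finite (words R A J)"
  by (rule finite_subset[OF _ finite_permutations_of_set[of A]])
     (auto simp: words_def permutations_of_set_def)

text \<open>The head of a nonempty word is one of its letters, so only the trace of \<open>J\<close>
  on the alphabet matters.\<close>

lemma words_cong:
  assumes "A = B" "J \<inter> A = K \<inter> A"
  shows "words R A J = words R B K"
proof -
  have "hd xs \<in> J \<longleftrightarrow> hd xs \<in> K" if "set xs = A" "xs \<noteq> []" for xs
    using assms(2) that hd_in_set by blast
  thus ?thesis using assms(1) by (auto simp: words_def)
qed

text \<open>A nonempty \<open>A\<close> rules out the empty word, which would be counted twice on
  the right.\<close>

lemma num_words_Un:
  assumes "finite A" "A \<noteq> {}" "J \<inter> K \<inter> A = {}"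
  shows "num_words A (J \<union> K) = num_words A J + num_words A K"
proof -
  have "words asc_ok A (J \<union> K) = words asc_ok A J \<union> words asc_ok A K"
    by (auto simp: words_def)
  moreover have "words asc_ok A J \<inter> words asc_ok A K = {}"
  proof (intro equals0I)
    fix xs assume xs: "xs \<in> words asc_ok A J \<inter> words asc_ok A K"
    hence "xs \<noteq> []" using assms(2) by (auto simp: words_def)
    thus False using xs assms(3) hd_in_set[of xs] by (auto simp: words_def)
  qed
  ultimately show ?thesis
    using assms(1) by (simp add: card_Un_disjoint)
qed

lemma num_words_sum:
  assumes "finite A" "A \<noteq> {}" "finite J"
  shows "num_words A J = (\<Sum>j\<in>J. num_words A {j})"
  using assms(3)
proof (induction J rule: finite_induct)
  case empty
  have "words asc_ok A {} = {}" using assms(2) by (auto simp: words_def)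
  thus ?case by simp
next
  case (insert x F)
  then show ?case using num_words_Un[OF assms(1,2), of "{x}" F] by auto
qed

text \<open>Deleting the leading \<open>z\<close> is a bijection; for \<open>A = {}\<close> it sends
  \<open>[z]\<close> to the empty word.\<close>

lemma num_words_Cons:
  assumes "z \<notin> A"
  shows "num_words (insert z A) {z} = num_words A {j. asc_ok z j}"
proof -
  have "words asc_ok (insert z A) {z} = Cons z ` words asc_ok A {j. asc_ok z j}"
  proof (intro equalityI subsetI)
    fix xs assume xs: "xs \<in> words asc_ok (insert z A) {z}"
    then obtain ys where "xs = z # ys" by (cases xs) (auto simp: words_def)
    with xs assms show "xs \<in> Cons z ` words asc_ok A {j. asc_ok z j}"
      by (auto simp: words_def successively_Cons insert_ident)
  qed (use assms in \<open>auto simp: words_def successively_Cons\<close>)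
  thus ?thesis by (simp add: card_image)
qed

text \<open>Letterwise renaming. With two relations, the renamed words may obey another condition
  than the original ones; agreement on distinct letters suffices because words repeat no
  letter.\<close>

lemma card_words_image:
  assumes "inj_on f A"
    and "\<And>a b. a \<in> A \<Longrightarrow> b \<in> A \<Longrightarrow> a \<noteq> b \<Longrightarrow> R' (f a) (f b) \<longleftrightarrow> R a b"
    and "\<And>a. a \<in> A \<Longrightarrow> f a \<in> K \<longleftrightarrow> a \<in> J"
  shows "card (words R' (f ` A) K) = card (words R A J)"
proof -
  have succ: "successively R' (map f xs) \<longleftrightarrow> successively R xs"
    if "set xs \<subseteq> A" "distinct xs" for xs
    using that assms(2) by (induction xs rule: induct_list012) auto
  have hd: "hd (map f xs) \<in> K \<longleftrightarrow> hd xs \<in> J" if "set xs = A" "xs \<noteq> []" for xs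
    using that assms(3) hd_in_set by (metis list.map_sel(1))
  have "words R' (f ` A) K = map f ` words R A J"
  proof (intro equalityI subsetI)
    fix ys assume ys: "ys \<in> words R' (f ` A) K"
    define xs where "xs = map (inv_into A f) ys"
    have "set ys = f ` A" using ys by (simp add: words_def)
    hence "map (f \<circ> inv_into A f) ys = ys"
      by (intro map_idI) (simp add: f_inv_into_f)
    hence 1: "map f xs = ys" by (simp add: xs_def)
    have "set xs = inv_into A f ` f ` A" using \<open>set ys = f ` A\<close> by (simp add: xs_def)
    hence 2: "set xs = A" using assms(1) by simp
    have "distinct (map f xs)" using ys 1 by (simp add: words_def)
    hence "distinct xs" by (simp add: distinct_map)
    with 1 2 ys have "xs \<in> words R A J"
      using succ[of xs] hd[of xs] by (auto simp: words_def)
    thus "ys \<in> map f ` words R A J" using 1 by blast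
  next
    fix ys assume "ys \<in> map f ` words R A J"
    then obtain xs where "ys = map f xs" "xs \<in> words R A J" by blast
    thus "ys \<in> words R' (f ` A) K"
      using succ[of xs] hd[of xs] assms(1) by (auto simp: words_def distinct_map)
  qed
  moreover have "inj_on (map f) (words R A J)"
    using assms(1) by (intro inj_onI) (auto simp: words_def dest: map_inj_on)
  ultimately show ?thesis by (simp add: card_image)
qed

section \<open>Permutation counts as word counts\<close>

lemma perms_I_eq_words: "perms_I m = words asc_ok {1..m} UNIV"
  by (auto simp: perms_I_def words_def permutations_of_set_def successively_conv_nth asc_ok_def)

lemma G_I_eq: "G_I m = num_words {1..m} UNIV"
  by (simp add: G_I_def perms_I_eq_words)

lemma G_I_first_eq:
  assumes "1 \<le> k" "k \<le> m"
  shows "G_I_first m k = num_words {1..m} {k}"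
proof -
  have "{\<pi> \<in> perms_I m. hd \<pi> = k} = words asc_ok {1..m} {k}"
    using assms by (auto simp: perms_I_eq_words words_def)
  thus ?thesis using assms by (simp add: G_I_first_def)
qed

lemma sum_G_I_first:
  assumes "J \<subseteq> {1..m}" "1 \<le> m"
  shows "(\<Sum>i\<in>J. G_I_first m i) = num_words {1..m} J"
proof -
  have "finite J" using assms(1) finite_subset by blast
  have "(\<Sum>i\<in>J. G_I_first m i) = (\<Sum>i\<in>J. num_words {1..m} {i})"
    using assms by (intro sum.cong) (auto simp: G_I_first_eq subset_iff)
  thus ?thesis using num_words_sum[OF _ _ \<open>finite J\<close>, of "{1..m}"] assms by simp
qed

section \<open>Deleting extreme letters: parts (a) and (e)\<close>

text \<open>An even least letter cannot be followed by a larger one, so it is last, and any larger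
  letter may precede it. The assumption \<open>z \<in> J\<close> covers empty \<open>A\<close>,
  where the only word is \<open>[z]\<close>.\<close>

lemma num_words_snoc:
  assumes "even z" "z \<in> J" "\<And>a. a \<in> A \<Longrightarrow> z < a"
  shows "num_words (insert z A) J = num_words A J"
proof -
  have "words asc_ok (insert z A) J = (\<lambda>xs. xs @ [z]) ` words asc_ok A J"
  proof (intro equalityI subsetI)
    fix xs assume xs: "xs \<in> words asc_ok (insert z A) J"
    hence "z \<in> set xs" by (simp add: words_def)
    then obtain X Y where *: "xs = X @ z # Y" by (meson split_list)
    have "Y = []"
    proof (cases Y)
      case (Cons y Y')
      hence "y \<in> set xs" "y \<noteq> z" "asc_ok z y" using xs *
        by (auto simp: words_def successively_append_iff)
      moreover from this have "z < y" using xs assms(3) by (simp add: words_def)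
      ultimately show ?thesis using assms(1) by (simp add: asc_ok_def)
    qed simp
    moreover have "z \<notin> A" using assms(3) by blast
    moreover have "successively asc_ok X"
      using xs * by (simp add: words_def successively_append_iff)
    ultimately have "X \<in> words asc_ok A J" using xs *
      by (cases X) (auto simp: words_def insert_ident insert_commute[of _ z])
    thus "xs \<in> (\<lambda>xs. xs @ [z]) ` words asc_ok A J" using * \<open>Y = []\<close> by blast
  next
    fix ys assume "ys \<in> (\<lambda>xs. xs @ [z]) ` words asc_ok A J"
    then obtain xs where xs: "ys = xs @ [z]" "xs \<in> words asc_ok A J" by blast
    have "asc_ok (last xs) z" if "xs \<noteq> []"
    proof -
      have "last xs \<in> A" using that xs by (auto simp: words_def)
      thus ?thesis using assms(3) by (force simp: asc_ok_def)
    qed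
    hence "successively asc_ok ys" using xs by (auto simp: words_def successively_append_iff)
    thus "ys \<in> words asc_ok (insert z A) J" using xs assms
      by (cases xs) (auto simp: words_def)
  qed
  thus ?thesis by (simp add: card_image inj_on_def)
qed

text \<open>Behind a leading 1 the word starts with an even letter and ends in 2; a leading 2 forces
  1 and then an even letter, if any. Both leave the same words on the letters from 3 on.\<close>

lemma first_one_two:
  assumes "1 \<le> n"
  shows "num_words {1..2*n} {1} = num_words {3..2*n} {j. even j}"
    and "num_words {1..2*n} {2} = num_words {3..2*n} {j. even j}"
proof -
  have "{1..2*n} = insert 1 {2..2*n}" using assms by auto
  hence "num_words {1..2*n} {1} = num_words {2..2*n} {j. asc_ok 1 j}"
    using num_words_Cons[of 1 "{2..2*n}"] by simp
  also have "words asc_ok {2..2*n} {j. asc_ok 1 j} = words asc_ok (insert 2 {3..2*n}) {j. even j}"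
    using assms by (intro words_cong) (auto simp: asc_ok_def)
  also have "card \<dots> = num_words {3..2*n} {j. even j}"
    by (rule num_words_snoc) auto
  finally show "num_words {1..2*n} {1} = num_words {3..2*n} {j. even j}" .
  have "{1..2*n} = insert 2 (insert 1 {3..2*n})" using assms by auto
  hence "num_words {1..2*n} {2} = num_words (insert 1 {3..2*n}) {j. asc_ok 2 j}"
    using num_words_Cons[of 2 "insert 1 {3..2*n}"] by simp
  also have "words asc_ok (insert 1 {3..2*n}) {j. asc_ok 2 j} = words asc_ok (insert 1 {3..2*n}) {1}"
    by (intro words_cong) (auto simp: asc_ok_def)
  also have "card \<dots> = num_words {3..2*n} {j. asc_ok 1 j}"
    by (rule num_words_Cons) auto
  also have "words asc_ok {3..2*n} {j. asc_ok 1 j} = words asc_ok {3..2*n} {j. even j}"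
    by (intro words_cong) (auto simp: asc_ok_def)
  finally show "num_words {1..2*n} {2} = num_words {3..2*n} {j. even j}" .
qed

text \<open>Shifting by two keeps order and parity. For \<open>n = 0\<close>,
  \<open>1 \<le> a\<close> makes the truncated interval \<open>{a..2*n - 2}\<close> empty.\<close>

lemma num_words_shift_two:
  assumes "1 \<le> a"
  shows "num_words {a + 2..2*n} {j. even j} = num_words {a..2*n - 2} {j. even j}"
proof -
  have "{a + 2..2*n} = (\<lambda>x. x + 2) ` {a..2*n - 2}"
    using assms by (auto simp: image_iff Bex_def) presburger
  moreover have "num_words ((\<lambda>x. x + 2) ` {a..2*n - 2}) {j. even j} = num_words {a..2*n - 2} {j. even j}"
    by (rule card_words_image) (auto simp: asc_ok_def inj_on_def)
  ultimately show ?thesis by simp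
qed

text \<open>A predecessor of \<open>z\<close> would be smaller, giving an ascent into an odd
  letter.\<close>

lemma words_max_odd:
  assumes "odd z" "\<And>a. a \<in> A \<Longrightarrow> a < z"
  shows "words asc_ok (insert z A) UNIV = words asc_ok (insert z A) {z}"
proof -
  have "hd xs = z" if xs: "xs \<in> words asc_ok (insert z A) UNIV" for xs
  proof -
    have "z \<in> set xs" using xs by (simp add: words_def)
    then obtain X Y where *: "xs = X @ z # Y" by (meson split_list)
    have "X = []"
    proof (rule ccontr)
      assume "X \<noteq> []"
      hence "last X \<in> set X" by simp
      moreover have "z \<notin> set X" "set X \<subseteq> insert z A" "asc_ok (last X) z"
        using xs * \<open>X \<noteq> []\<close> by (auto simp: words_def successively_append_iff)
      ultimately have "last X < z" "asc_ok (last X) z" using assms(2) by auto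
      thus False using assms(1) by (simp add: asc_ok_def)
    qed
    thus ?thesis using * by simp
  qed
  thus ?thesis by (auto simp: words_def)
qed

text \<open>Any letter may follow the leading \<open>2*n\<close>; then \<open>2*n - 1\<close> is an
  odd maximum, hence comes first and again restricts nothing.\<close>

lemma first_largest:
  assumes "1 \<le> n"
  shows "num_words {1..2*n} {2*n} = num_words {1..2*n - 2} UNIV"
proof -
  define A where "A = {1..2*n - 2}"
  define z where "z = 2*n - 1"
  have A: "{1..2*n} = insert (z + 1) (insert z A)" "\<And>a. a \<in> A \<Longrightarrow> a < z" "odd z" "2*n = z + 1"
    using assms by (auto simp: A_def z_def)
  have asc: "asc_ok z a" "asc_ok (z + 1) a" "asc_ok (z + 1) z" if "a \<in> A" for a
    using A(2)[OF that] by (simp_all add: asc_ok_def)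
  have "num_words {1..2*n} {2*n} = num_words (insert z A) {j. asc_ok (z + 1) j}"
    using A(2)[of "z + 1"] num_words_Cons[of "z + 1" "insert z A"] unfolding A(1) by (auto simp: A(4))
  also have "words asc_ok (insert z A) {j. asc_ok (z + 1) j} = words asc_ok (insert z A) UNIV"
    using asc by (intro words_cong) (auto simp: asc_ok_def)
  also have "words asc_ok (insert z A) UNIV = words asc_ok (insert z A) {z}"
    using A by (intro words_max_odd)
  also have "card \<dots> = num_words A {j. asc_ok z j}"
    using A by (intro num_words_Cons) auto
  also have "words asc_ok A {j. asc_ok z j} = words asc_ok A UNIV"
    using asc by (intro words_cong) (auto simp: asc_ok_def)
  finally show ?thesis by (simp add: A_def)
qed

section \<open>Inserting a factor into a split word: parts (b) and (d)\<close>

text \<open>Nothing is asked of the two letters at the cut: after an insertion they are no longer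
  adjacent.\<close>

definition splits :: "'a set \<Rightarrow> ('a list \<times> 'a list) set" where
  "splits C = {(X, Y). distinct (X @ Y) \<and> set (X @ Y) = C}"

lemma finite_splits: "finite C \<Longrightarrow> finite (splits C)"
proof -
  assume "finite C"
  hence "finite ((\<Union>B\<in>Pow C. permutations_of_set B) \<times> (\<Union>B\<in>Pow C. permutations_of_set B))"
    by auto
  moreover have "splits C \<subseteq> (\<Union>B\<in>Pow C. permutations_of_set B) \<times> (\<Union>B\<in>Pow C. permutations_of_set B)"
    by (auto simp: splits_def permutations_of_set_def)
  ultimately show ?thesis using finite_subset by blast
qed

text \<open>Deleting the factor leaves a split, which is unique because \<open>z\<close> occurs only
  once. The term \<open>hd (X @ [z])\<close> is the first letter of the whole word even for empty
  \<open>X\<close>.\<close>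

lemma card_words_factor:
  assumes "distinct (z # us)" "set (z # us) \<inter> C = {}"
  shows "card {xs \<in> words R (set (z # us) \<union> C) J. \<exists>X Y. xs = X @ (z # us) @ Y} =
         card {(X, Y) \<in> splits C. successively R (X @ (z # us) @ Y) \<and> hd (X @ [z]) \<in> J}"
    (is "card ?L = card ?P")
proof -
  let ?f = "\<lambda>(X, Y). X @ (z # us) @ Y"
  have "?L = ?f ` ?P"
  proof (intro equalityI subsetI)
    fix xs assume xs: "xs \<in> ?L"
    then obtain X Y where *: "xs = X @ (z # us) @ Y" by blast
    have d: "distinct (X @ (z # us) @ Y)" and s: "set (X @ (z # us) @ Y) = set (z # us) \<union> C"
      and r: "successively R (X @ (z # us) @ Y)" and h: "hd (X @ [z]) \<in> J"
      using xs unfolding * by (cases X; auto simp: words_def)+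
    have "set (X @ Y) = set (X @ (z # us) @ Y) - set (z # us)" using d by auto
    also have "\<dots> = C" using s assms(2) by auto
    finally have "(X, Y) \<in> ?P" using d r h by (auto simp: splits_def)
    thus "xs \<in> ?f ` ?P" using * by force
  next
    fix xs assume "xs \<in> ?f ` ?P"
    then obtain X Y where "(X, Y) \<in> ?P" and *: "xs = X @ (z # us) @ Y" by auto
    hence "set (X @ Y) = C" "distinct (X @ Y)" "successively R xs" "hd (X @ [z]) \<in> J"
      by (auto simp: splits_def)
    moreover from this have "hd xs \<in> J" by (cases X) (simp_all add: *)
    moreover have "distinct xs" "set xs = set (z # us) \<union> C"
      using assms calculation(1,2) by (auto simp: *)
    ultimately show "xs \<in> ?L" using * by (auto simp: words_def)
  qed
  moreover have "inj_on ?f ?P"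
  proof (intro inj_onI, clarify)
    fix X Y X' Y' assume "(X, Y) \<in> splits C" "(X', Y') \<in> splits C"
      and eq: "X @ (z # us) @ Y = X' @ (z # us) @ Y'"
    hence "z \<notin> set X" "z \<notin> set X'" "z \<notin> set Y" "z \<notin> set Y'" "z \<notin> set us"
      using assms by (auto simp: splits_def)
    with eq have "X = X' \<and> us @ Y = us @ Y'"
      using append_Cons_eq_iff[of z X "us @ Y" X' "us @ Y'"] by simp
    thus "X = X' \<and> Y = Y'" by simp
  qed
  ultimately show ?thesis by (simp add: card_image)
qed

lemma card_words_insert:
  assumes "z \<notin> C"
  shows "card (words R (insert z C) J) =
         card {(X, Y) \<in> splits C. successively R (X @ z # Y) \<and> hd (X @ [z]) \<in> J}"
proof -
  have "{xs \<in> words R (set [z] \<union> C) J. \<exists>X Y. xs = X @ [z] @ Y} = words R (insert z C) J"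
    by (auto simp: words_def intro!: split_list[simplified])
  thus ?thesis using card_words_factor[of z "[]" C R J] assms by simp
qed

text \<open>The odd letter \<open>2*n - 1\<close> is either first or directly preceded by
  \<open>2*n\<close>. In either case deleting it yields each word on the other letters exactly
  once.\<close>

lemma first_second_largest:
  assumes "1 \<le> n"
  shows "2 * num_words {1..2*n} {2*n - 1} = num_words {1..2*n} UNIV"
proof -
  define A where "A = {1..2*n - 2}"
  define q where "q = 2*n - 1"
  define p where "p = 2*n"
  have "p = Suc q" "odd q" using assms by (auto simp: p_def q_def)
  have A: "a < q" if "a \<in> A" for a using that by (auto simp: A_def q_def)
  have asc: "asc_ok p a" "asc_ok q a" if "a \<in> A" for a
    using A[OF that] \<open>p = Suc q\<close> by (simp_all add: asc_ok_def)
  have notin: "p \<notin> A" "q \<notin> A" "p \<noteq> q" using A \<open>p = Suc q\<close> by force+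
  have asc': "asc_ok p q" "asc_ok q p" using \<open>odd q\<close> by (simp_all add: asc_ok_def \<open>p = Suc q\<close>)
  have eq: "{1..2*n} = insert q (insert p A)" using assms by (auto simp: A_def p_def q_def)

  have first: "num_words {1..2*n} {q} = num_words (insert p A) {j. asc_ok q j}"
    unfolding eq using notin by (intro num_words_Cons) auto
  have "words asc_ok (insert p A) {j. asc_ok q j} = words asc_ok (insert p A) UNIV"
    using asc asc' by (intro words_cong) auto
  with first have q: "num_words {1..2*n} {q} =
      card {(X, Y) \<in> splits A. successively asc_ok (X @ p # Y)}"
    using notin by (simp add: card_words_insert)

  have "words asc_ok {1..2*n} (- {q}) =
      {xs \<in> words asc_ok (set [p, q] \<union> A) UNIV. \<exists>X Y. xs = X @ [p, q] @ Y}" (is "_ = ?F")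
  proof (intro equalityI subsetI)
    fix xs assume xs: "xs \<in> words asc_ok {1..2*n} (- {q})"
    hence s: "set xs = insert q (insert p A)" "distinct xs" "successively asc_ok xs" "hd xs \<noteq> q" "xs \<noteq> []"
      unfolding eq by (auto simp: words_def)
    then obtain X Y where *: "xs = X @ q # Y" by (metis insertI1 split_list)
    with s have "X \<noteq> []" by auto
    then obtain X' b where X: "X = X' @ [b]" by (metis rev_exhaust)
    have "b \<in> insert p A" "asc_ok b q" using s * X by (auto simp: successively_append_iff)
    \<comment> \<open>A predecessor from \<open>A\<close> would form an ascent into the odd letter
      \<open>q\<close>, so only \<open>p\<close> can stand before it.\<close>
    moreover have "b \<notin> A" using A \<open>asc_ok b q\<close> \<open>odd q\<close> by (auto simp: asc_ok_def)
    ultimately have "xs = X' @ [p, q] @ Y" using * X by simp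
    moreover have "xs \<in> words asc_ok (set [p, q] \<union> A) UNIV" using s by (auto simp: words_def)
    ultimately show "xs \<in> ?F" by blast
  next
    fix xs assume "xs \<in> ?F"
    then obtain X Y where xs: "xs = X @ [p, q] @ Y" "xs \<in> words asc_ok (set [p, q] \<union> A) UNIV" by blast
    hence "set xs = insert q (insert p A)" "distinct xs" "successively asc_ok xs"
      by (auto simp: words_def)
    moreover have "hd xs \<noteq> q" using \<open>distinct xs\<close> xs(1) by (cases X) auto
    ultimately show "xs \<in> words asc_ok {1..2*n} (- {q})" unfolding eq by (simp add: words_def)
  qed
  hence "num_words {1..2*n} (- {q}) =
      card {(X, Y) \<in> splits A. successively asc_ok (X @ p # q # Y)}"
    using card_words_factor[of p "[q]" A asc_ok UNIV] notin by simp
  also have "{(X, Y) \<in> splits A. successively asc_ok (X @ p # q # Y)} =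
      {(X, Y) \<in> splits A. successively asc_ok (X @ p # Y)}"
  proof -
    have "successively asc_ok (X @ p # q # Y) \<longleftrightarrow> successively asc_ok (X @ p # Y)"
      if "(X, Y) \<in> splits A" for X Y
    proof -
      have "set Y \<subseteq> A" using that by (auto simp: splits_def)
      thus ?thesis using asc asc'
        by (cases Y) (auto simp: successively_append_iff)
    qed
    thus ?thesis by blast
  qed
  finally have "num_words {1..2*n} (- {q}) = num_words {1..2*n} {q}" using q by simp
  moreover have "num_words {1..2*n} ({q} \<union> - {q}) = num_words {1..2*n} {q} + num_words {1..2*n} (- {q})"
    by (rule num_words_Un) (use assms in auto)
  ultimately show ?thesis by (simp add: q_def)
qed

text \<open>The 2 is last or followed by 1, and in both cases deleting it leaves an arbitrary word
  without 2 that starts with 3; hence the factor 2. Behind the leading 3 comes 1 or an even letter,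
  which gives the two summands.\<close>

lemma first_three:
  assumes "2 \<le> n"
  shows "num_words {1..2*n} {3} = 2 * (num_words {1..2*n} {1} + num_words {1..2*n - 2} {1})"
proof -
  define A where "A = {3..2*n}"
  have eq: "{1..2*n} = insert 2 (insert 1 A)" using assms by (auto simp: A_def)
  define L where "L = {xs. last xs = (2::nat)}"
  have notlast: "words asc_ok {1..2*n} {3} - L =
      {xs \<in> words asc_ok (set [2, 1] \<union> A) {3}. \<exists>X Y. xs = X @ [2, 1] @ Y}" (is "_ = ?F")
  proof (intro equalityI subsetI)
    fix xs assume xs: "xs \<in> words asc_ok {1..2*n} {3} - L"
    hence s: "set xs = insert 2 (insert 1 A)" "distinct xs" "successively asc_ok xs" "last xs \<noteq> 2"
      unfolding eq by (auto simp: words_def L_def)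
    then obtain X Y where *: "xs = X @ 2 # Y" by (metis insertI1 split_list)
    with s obtain y Y' where Y: "Y = y # Y'" by (cases Y) auto
    have "y \<in> insert 1 A" "asc_ok 2 y" using s * Y by (auto simp: successively_append_iff)
    hence "y = 1" by (auto simp: asc_ok_def A_def)
    hence "xs = X @ [2, 1] @ Y'" using * Y by simp
    moreover have "xs \<in> words asc_ok (set [2, 1] \<union> A) {3}" using xs eq by simp
    ultimately show "xs \<in> ?F" by blast
  next
    fix xs assume "xs \<in> ?F"
    then obtain X Y where xs: "xs = X @ [2, 1] @ Y" "xs \<in> words asc_ok (set [2, 1] \<union> A) {3}" by blast
    hence "distinct xs" by (simp add: words_def)
    have "last xs \<in> insert 1 (set Y)" using xs(1) by simp
    hence "last xs \<noteq> 2" using \<open>distinct xs\<close> xs(1) by auto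
    thus "xs \<in> words asc_ok {1..2*n} {3} - L" using xs(2) unfolding eq by (simp add: L_def)
  qed
  have "card (words asc_ok {1..2*n} {3} - L) =
      card {(X, Y) \<in> splits A. successively asc_ok (X @ 2 # 1 # Y) \<and> hd (X @ [2]) \<in> {3}}"
    unfolding notlast using card_words_factor[of 2 "[1]" A asc_ok "{3}"] by (simp add: A_def)
  also have "{(X, Y) \<in> splits A. successively asc_ok (X @ 2 # 1 # Y) \<and> hd (X @ [2]) \<in> {3}} =
      {(X, Y) \<in> splits A. successively asc_ok (X @ 1 # Y) \<and> hd (X @ [1]) \<in> {3}}"
  proof -
    \<comment> \<open>For empty \<open>X\<close> both sides fail, as the first letter would be 2 or
      1. Otherwise the letter before the cut is at least 3 and may precede 2 as well as 1.\<close>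
    have "successively asc_ok (X @ 2 # 1 # Y) \<and> hd (X @ [2]) = 3 \<longleftrightarrow>
          successively asc_ok (X @ 1 # Y) \<and> hd (X @ [1]) = 3"
      if "(X, Y) \<in> splits A" for X Y
    proof (cases "X = []")
      case False
      hence "last X \<in> A" using that last_in_set[of X] by (auto simp: splits_def)
      hence "asc_ok (last X) 1" "asc_ok (last X) 2" "asc_ok 2 1" by (auto simp: asc_ok_def A_def)
      thus ?thesis using False by (auto simp: successively_append_iff)
    qed auto
    thus ?thesis by blast
  qed
  also have "card \<dots> = num_words (insert 1 A) {3}"
    by (rule card_words_insert[symmetric]) (simp add: A_def)
  finally have 1: "card (words asc_ok {1..2*n} {3} - L) = num_words (insert 1 A) {3}" .

  have "words asc_ok {1..2*n} {3} \<inter> L = (\<lambda>xs. xs @ [2]) ` words asc_ok (insert 1 A) {3}"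
  proof (intro equalityI subsetI)
    fix xs assume xs: "xs \<in> words asc_ok {1..2*n} {3} \<inter> L"
    hence s: "set xs = insert 2 (insert 1 A)" "distinct xs" "successively asc_ok xs" "last xs = 2"
      "hd xs = 3" "xs \<noteq> []"
      unfolding eq by (auto simp: words_def L_def)
    then obtain X where X: "xs = X @ [2]" by (metis append_butlast_last_id)
    have "set X = insert 1 A" 
    proof -
      have "set X = set xs - {2}" using s(2) X by auto
      thus ?thesis using s(1) by (auto simp: A_def)
    qed
    moreover have "X \<noteq> []" using X s(5) by auto
    ultimately have "X \<in> words asc_ok (insert 1 A) {3}"
      using s X by (auto simp: words_def successively_append_iff)
    thus "xs \<in> (\<lambda>xs. xs @ [2]) ` words asc_ok (insert 1 A) {3}" using X by blast
  next
    fix ys assume "ys \<in> (\<lambda>xs. xs @ [2]) ` words asc_ok (insert 1 A) {3}"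
    then obtain xs where ys: "ys = xs @ [2]" and xs: "xs \<in> words asc_ok (insert 1 A) {3}" by blast
    hence "xs \<noteq> []" by (auto simp: words_def)
    hence "last xs \<in> insert 1 A" using xs last_in_set[of xs] by (auto simp: words_def)
    hence "asc_ok (last xs) 2" by (auto simp: asc_ok_def A_def)
    hence "successively asc_ok ys" using xs ys by (simp add: words_def successively_append_iff)
    thus "ys \<in> words asc_ok {1..2*n} {3} \<inter> L"
      using xs ys \<open>xs \<noteq> []\<close> unfolding eq by (auto simp: words_def L_def A_def)
  qed
  hence 2: "card (words asc_ok {1..2*n} {3} \<inter> L) = num_words (insert 1 A) {3}"
    by (simp add: card_image inj_on_def)

  have "num_words {1..2*n} {3} =
      card (words asc_ok {1..2*n} {3} \<inter> L) + card (words asc_ok {1..2*n} {3} - L)"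
    by (rule card_Int_Diff) simp
  hence two: "num_words {1..2*n} {3} = 2 * num_words (insert 1 A) {3}" using 1 2 by simp

  define B where "B = {4..2*n}"
  have A: "A = insert 3 B" using assms by (auto simp: A_def B_def)
  have "num_words (insert 1 A) {3} = num_words (insert 3 (insert 1 B)) {3}"
    by (simp add: A insert_commute)
  also have "\<dots> = num_words (insert 1 B) {j. asc_ok 3 j}"
    by (rule num_words_Cons) (simp add: B_def)
  also have "words asc_ok (insert 1 B) {j. asc_ok 3 j} = words asc_ok (insert 1 B) ({1} \<union> {j. even j})"
    by (intro words_cong) (auto simp: asc_ok_def B_def)
  also have "card \<dots> = num_words (insert 1 B) {1} + num_words (insert 1 B) {j. even j}"
    by (rule num_words_Un) (auto simp: B_def)
  also have "num_words (insert 1 B) {1} = num_words B {j. asc_ok 1 j}"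
    by (rule num_words_Cons) (simp add: B_def)
  also have "words asc_ok B {j. asc_ok 1 j} = words asc_ok {2 + 2..2*n} {j. even j}"
    by (intro words_cong) (auto simp: asc_ok_def B_def)
  also have "card \<dots> = num_words {2..2*n - 2} {j. even j}"
    by (rule num_words_shift_two) simp
  also have "words asc_ok {2..2*n - 2} {j. even j} = words asc_ok {2..2*n - 2} {j. asc_ok 1 j}"
    by (intro words_cong) (auto simp: asc_ok_def)
  also have "card \<dots> = num_words (insert 1 {2..2*n - 2}) {1}"
    by (rule num_words_Cons[symmetric]) simp
  also have "insert 1 {2..2*n - 2} = {1..2*n - 2}" using assms by auto
  also have "num_words (insert 1 B) {j. even j} = num_words A {j. even j}"
  proof -
    \<comment> \<open>Since 3 is the least letter of \<open>A\<close>, replacing it by the odd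
      letter 1 changes neither comparisons nor parities.\<close>
    have "insert 1 B = (\<lambda>x. if x = 3 then 1 else x) ` A" by (auto simp: A B_def)
    moreover have "num_words ((\<lambda>x. if x = 3 then 1 else x) ` A) {j. even j} = num_words A {j. even j}"
      by (rule card_words_image) (auto simp: asc_ok_def A B_def inj_on_def)
    ultimately show ?thesis by simp
  qed
  also have "num_words A {j. even j} = num_words {1..2*n} {1}"
    using first_one_two(1)[of n] assms by (simp add: A_def)
  finally show ?thesis using two by simp
qed

section \<open>Crossings of a level\<close>

text \<open>Crossings are pairs of pieces rather than positions, so that they can be compared with
  splits.\<close>

definition downs :: "nat \<Rightarrow> nat list \<Rightarrow> (nat list \<times> nat list) set" where
  "downs v Z = {(X, Y). X @ Y = Z \<and> X \<noteq> [] \<and> v < last X \<and> (Y = [] \<or> hd Y < v)}"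

definition ups :: "nat \<Rightarrow> nat list \<Rightarrow> (nat list \<times> nat list) set" where
  "ups v Z = {(X, Y). X @ Y = Z \<and> X \<noteq> [] \<and> last X < v \<and> Y \<noteq> [] \<and> v < hd Y}"

lemma finite_crossings: "finite (downs v Z)" "finite (ups v Z)"
proof -
  have "finite ((\<lambda>i. (take i Z, drop i Z)) ` {..length Z})" by simp
  moreover have "(X, Y) \<in> (\<lambda>i. (take i Z, drop i Z)) ` {..length Z}" if "X @ Y = Z" for X Y
    using that by (auto intro!: image_eqI[of _ _ "length X"])
  hence "downs v Z \<subseteq> (\<lambda>i. (take i Z, drop i Z)) ` {..length Z}"
    "ups v Z \<subseteq> (\<lambda>i. (take i Z, drop i Z)) ` {..length Z}"
    by (auto simp: downs_def ups_def)
  ultimately show "finite (downs v Z)" "finite (ups v Z)" using finite_subset by blast+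
qed

text \<open>A cut at the very end of a word that ends above \<open>v\<close> counts as a down-crossing: every word
  returns below \<open>v\<close>.\<close>

lemma card_downs_eq_card_ups:
  assumes "Z \<noteq> []" "v \<notin> set Z"
  shows "card (downs v Z) = card (ups v Z) + (if v < hd Z then 1 else 0)"
  using assms
proof (induction Z rule: induct_list012)
  case (2 a)
  have "downs v [a] = (if v < a then {([a], [])} else {})"
    by (auto simp: downs_def append_eq_Cons_conv)
  moreover have "ups v [a] = {}" by (auto simp: ups_def append_eq_Cons_conv)
  ultimately show ?case by simp
next
  case (3 a b Z)
  let ?f = "\<lambda>(X, Y). (a # X, Y)"
  have IH: "card (downs v (b # Z)) = card (ups v (b # Z)) + (if v < b then 1 else 0)"
    using 3 by simp
  have inj: "inj_on ?f S" for S by (auto simp: inj_on_def)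
  \<comment> \<open>Prepending \<open>a\<close> carries the old cuts along and can add only the cut
    between \<open>a\<close> and \<open>b\<close>.\<close>
  have "downs v (a # b # Z) = ?f ` downs v (b # Z) \<union> (if v < a \<and> b < v then {([a], b # Z)} else {})"
    by (auto simp: downs_def append_eq_Cons_conv image_iff split: if_splits)
  moreover have "([a], b # Z) \<notin> ?f ` downs v (b # Z)" by (auto simp: downs_def)
  ultimately have 1: "card (downs v (a # b # Z)) = card (downs v (b # Z)) + (if v < a \<and> b < v then 1 else 0)"
    by (simp add: finite_crossings card_image[OF inj])
  have "ups v (a # b # Z) = ?f ` ups v (b # Z) \<union> (if a < v \<and> v < b then {([a], b # Z)} else {})"
    by (auto simp: ups_def append_eq_Cons_conv image_iff split: if_splits)
  moreover have "([a], b # Z) \<notin> ?f ` ups v (b # Z)" by (auto simp: ups_def)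
  ultimately have 2: "card (ups v (a # b # Z)) = card (ups v (b # Z)) + (if a < v \<and> v < b then 1 else 0)"
    by (simp add: finite_crossings card_image[OF inj])
  \<comment> \<open>By \<open>3(4)\<close> neither \<open>a\<close> nor \<open>b\<close> equals
    \<open>v\<close>, so a new crossing arises exactly when the head changes sides.\<close>
  show ?case using 1 2 IH 3(4) by (auto split: if_splits)
qed simp

text \<open>A cut \<open>(X, Y)\<close> determines its word \<open>X @ Y\<close>, so different words
  contribute disjoint sets.\<close>

lemma card_UN_crossings:
  assumes "finite W" "\<And>Z. finite (D Z)" "\<And>Z X Y. (X, Y) \<in> D Z \<Longrightarrow> X @ Y = Z"
  shows "card (\<Union>Z\<in>W. D Z) = (\<Sum>Z\<in>W. card (D Z))"
proof (rule card_UN_disjoint[OF assms(1)])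
  show "\<forall>Z\<in>W. \<forall>Z'\<in>W. Z \<noteq> Z' \<longrightarrow> D Z \<inter> D Z' = {}"
    using assms(3) by (metis disjoint_iff surj_pair)
qed (use assms(2) in blast)

section \<open>Words on three consecutive levels\<close>

text \<open>Makes the absence of a factor a condition on neighbours, so that
  \<open>card_words_image\<close> applies to the words avoiding it.\<close>

lemma successively_avoiding_factor:
  "successively (\<lambda>a b. R a b \<and> \<not> (a = p \<and> b = q)) xs \<longleftrightarrow>
     successively R xs \<and> \<not> (\<exists>X Y. xs = X @ [p, q] @ Y)"
proof (induction xs rule: induct_list012)
  case (3 a b xs)
  have "(\<exists>X Y. a # b # xs = X @ [p, q] @ Y) \<longleftrightarrow>
      a = p \<and> b = q \<or> (\<exists>X Y. b # xs = X @ [p, q] @ Y)" (is "?l \<longleftrightarrow> ?r")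
  proof
    assume ?l
    then obtain X Y where "a # b # xs = X @ [p, q] @ Y" by blast
    thus ?r by (cases X) auto
  next
    assume ?r
    thus ?l
    proof
      assume "\<exists>X Y. b # xs = X @ [p, q] @ Y"
      then obtain X Y where "b # xs = X @ [p, q] @ Y" by blast
      hence "a # b # xs = (a # X) @ [p, q] @ Y" by simp
      thus ?l by blast
    next
      assume "a = p \<and> b = q"
      hence "a # b # xs = [] @ [p, q] @ xs" by simp
      thus ?l by blast
    qed
  qed
  thus ?case using "3.IH" by auto
qed auto

text \<open>Into a split \<open>(X, Y)\<close> of a word on \<open>C\<close> one inserts \<open>v\<close>, \<open>v + 1\<close> or the block \<open>v + 2, v + 1\<close>;
  since no letter of \<open>C\<close> lies among the three levels, only the position relative to \<open>v\<close> and the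
  parity of the neighbouring letters matter.\<close>

locale three_levels =
  fixes v :: nat and C :: "nat set"
  assumes finite_C: "finite C" and even_v: "even v"
    and notin: "v \<notin> C" "v + 1 \<notin> C" "v + 2 \<notin> C"
begin

lemma level_less:
  assumes "c \<in> C"
  shows "c < v + 1 \<longleftrightarrow> c < v" "c < v + 2 \<longleftrightarrow> c < v"
    "v + 1 < c \<longleftrightarrow> v < c" "v + 2 < c \<longleftrightarrow> v < c" "c < v \<longleftrightarrow> \<not> v < c"
proof -
  have "c \<noteq> v" "c \<noteq> v + 1" "c \<noteq> v + 2" using assms notin by auto
  thus "c < v + 1 \<longleftrightarrow> c < v" "c < v + 2 \<longleftrightarrow> c < v"
    "v + 1 < c \<longleftrightarrow> v < c" "v + 2 < c \<longleftrightarrow> v < c" "c < v \<longleftrightarrow> \<not> v < c" by auto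
qed

text \<open>Towards \<open>C\<close> the letters \<open>v\<close> and \<open>v + 2\<close> behave
  alike, so renaming one into the other can matter only next to \<open>v + 1\<close>.\<close>

lemma level_asc_ok:
  assumes "c \<in> C"
  shows "asc_ok c v \<longleftrightarrow> v < c \<or> odd c" "asc_ok c (v + 2) \<longleftrightarrow> v < c \<or> odd c"
    "asc_ok c (v + 1) \<longleftrightarrow> v < c"
    "asc_ok v c \<longleftrightarrow> c < v" "asc_ok (v + 2) c \<longleftrightarrow> c < v"
    "asc_ok (v + 1) c \<longleftrightarrow> c < v \<or> even c"
  using level_less[OF assms] even_v by (auto simp: asc_ok_def)

text \<open>The conditions common to all three insertions. \<open>X\<close> is nonempty because the
  first letter must lie below \<open>v\<close>, which no inserted letter does.\<close>

definition low_splits :: "(nat list \<times> nat list) set" where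
  "low_splits = {(X, Y) \<in> splits C. successively asc_ok X \<and> successively asc_ok Y \<and> X \<noteq> [] \<and> hd X < v}"

definition last_above :: "nat list \<Rightarrow> bool" where "last_above X \<longleftrightarrow> v < last X"
text \<open>Here and in \<open>next_even\<close> an empty \<open>Y\<close> counts as true: a letter
  inserted at the end has no successor to satisfy.\<close>

definition next_below :: "nat list \<Rightarrow> bool" where "next_below Y \<longleftrightarrow> Y = [] \<or> hd Y < v"
definition last_odd :: "nat list \<Rightarrow> bool" where "last_odd X \<longleftrightarrow> odd (last X)"
definition next_even :: "nat list \<Rightarrow> bool" where "next_even Y \<longleftrightarrow> Y = [] \<or> even (hd Y)"

lemma low_splits_ends:
  assumes "(X, Y) \<in> low_splits"
  shows "X \<noteq> []" "last X \<in> C" "Y \<noteq> [] \<Longrightarrow> hd Y \<in> C"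
    "successively asc_ok X" "successively asc_ok Y" "hd X < v"
  using assms last_in_set[of X] hd_in_set[of Y] by (auto simp: low_splits_def splits_def)

lemma num_insert_low:
  "num_words (insert v C) {..<v} = card {(X, Y) \<in> low_splits. (last_above X \<or> last_odd X) \<and> next_below Y}"
proof -
  have "{(X, Y) \<in> splits C. successively asc_ok (X @ v # Y) \<and> hd (X @ [v]) \<in> {..<v}} =
      {(X, Y) \<in> low_splits. (last_above X \<or> last_odd X) \<and> next_below Y}"
  proof (intro set_eqI, clarify)
    fix X Y
    show "(X, Y) \<in> {(X, Y) \<in> splits C. successively asc_ok (X @ v # Y) \<and> hd (X @ [v]) \<in> {..<v}} \<longleftrightarrow>
      (X, Y) \<in> {(X, Y) \<in> low_splits. (last_above X \<or> last_odd X) \<and> next_below Y}"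
    proof (cases "(X, Y) \<in> low_splits")
      case True
      note e = low_splits_ends[OF True]
      show ?thesis using e level_asc_ok[OF e(2)] level_asc_ok[OF e(3)] True
        by (auto simp: low_splits_def last_above_def next_below_def last_odd_def
              successively_append_iff successively_Cons)
    qed (auto simp: low_splits_def successively_append_iff successively_Cons hd_append split: if_splits)
  qed
  thus ?thesis using notin by (simp add: card_words_insert)
qed

lemma num_insert_mid:
  "num_words (insert (v + 1) C) {..<v} = card {(X, Y) \<in> low_splits. last_above X \<and> (next_below Y \<or> next_even Y)}"
proof -
  have "{(X, Y) \<in> splits C. successively asc_ok (X @ (v + 1) # Y) \<and> hd (X @ [v + 1]) \<in> {..<v}} =
      {(X, Y) \<in> low_splits. last_above X \<and> (next_below Y \<or> next_even Y)}"
  proof (intro set_eqI, clarify)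
    fix X Y
    show "(X, Y) \<in> {(X, Y) \<in> splits C. successively asc_ok (X @ (v + 1) # Y) \<and> hd (X @ [v + 1]) \<in> {..<v}} \<longleftrightarrow>
      (X, Y) \<in> {(X, Y) \<in> low_splits. last_above X \<and> (next_below Y \<or> next_even Y)}"
    proof (cases "(X, Y) \<in> low_splits")
      case True
      note e = low_splits_ends[OF True]
      show ?thesis using e level_asc_ok[OF e(2)] level_asc_ok[OF e(3)] True
        by (auto simp: low_splits_def last_above_def next_below_def next_even_def
              successively_append_iff successively_Cons)
    qed (auto simp: low_splits_def successively_append_iff successively_Cons hd_append split: if_splits)
  qed
  thus ?thesis using notin by (simp add: card_words_insert)
qed

text \<open>Only \<open>v + 2\<close> meets the left neighbour and only \<open>v + 1\<close> the
  right one, so the left condition of \<open>v\<close> combines with the right condition of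
  \<open>v + 1\<close>.\<close>

lemma num_factor:
  "card {xs \<in> words asc_ok (insert (v + 2) (insert (v + 1) C)) {..<v}. \<exists>X Y. xs = X @ [v + 2, v + 1] @ Y} =
   card {(X, Y) \<in> low_splits. (last_above X \<or> last_odd X) \<and> (next_below Y \<or> next_even Y)}"
proof -
  have *: "asc_ok (v + 2) (v + 1)" by (simp add: asc_ok_def)
  have "{(X, Y) \<in> splits C. successively asc_ok (X @ [v + 2, v + 1] @ Y) \<and> hd (X @ [v + 2]) \<in> {..<v}} =
      {(X, Y) \<in> low_splits. (last_above X \<or> last_odd X) \<and> (next_below Y \<or> next_even Y)}"
  proof (intro set_eqI, clarify)
    fix X Y
    show "(X, Y) \<in> {(X, Y) \<in> splits C. successively asc_ok (X @ [v + 2, v + 1] @ Y) \<and> hd (X @ [v + 2]) \<in> {..<v}} \<longleftrightarrow>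
      (X, Y) \<in> {(X, Y) \<in> low_splits. (last_above X \<or> last_odd X) \<and> (next_below Y \<or> next_even Y)}"
    proof (cases "(X, Y) \<in> low_splits")
      case True
      note e = low_splits_ends[OF True]
      show ?thesis using e level_asc_ok[OF e(2)] level_asc_ok[OF e(3)] True *
        by (auto simp: low_splits_def last_above_def next_below_def last_odd_def next_even_def
              successively_append_iff successively_Cons)
    qed (auto simp: low_splits_def successively_append_iff successively_Cons hd_append split: if_splits)
  qed
  thus ?thesis using notin card_words_factor[of "v + 2" "[v + 1]" C asc_ok "{..<v}"] by simp
qed

text \<open>On the left the pieces meet in a descent through \<open>v\<close> or \<open>Y\<close> is
  empty, on the right they meet in an ascent from odd to even. Hence they glue to a word starting
  below \<open>v\<close>, and the two sides count its down-crossings and up-crossings.\<close>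

lemma num_crossings:
  "card {(X, Y) \<in> low_splits. last_above X \<and> next_below Y} =
   card {(X, Y) \<in> low_splits. \<not> last_above X \<and> last_odd X \<and> \<not> next_below Y \<and> next_even Y}"
proof -
  let ?W = "words asc_ok C {..<v} - {[]}"
  have "{(X, Y) \<in> low_splits. last_above X \<and> next_below Y} = (\<Union>Z\<in>?W. downs v Z)"
  proof (intro set_eqI iffI; clarify)
    fix X Y assume *: "(X, Y) \<in> low_splits" "last_above X" "next_below Y"
    note e = low_splits_ends[OF *(1)]
    have "Y \<noteq> [] \<Longrightarrow> asc_ok (last X) (hd Y)" using * by (auto simp: asc_ok_def last_above_def next_below_def)
    hence "X @ Y \<in> ?W" using * e
      by (auto simp: words_def low_splits_def splits_def successively_append_iff)
    thus "(X, Y) \<in> (\<Union>Z\<in>?W. downs v Z)" using * e by (auto simp: downs_def last_above_def next_below_def)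
  next
    fix Z X Y assume "Z \<in> words asc_ok C {..<v}" "Z \<noteq> []" "(X, Y) \<in> downs v Z"
    thus "(X, Y) \<in> low_splits \<and> last_above X \<and> next_below Y"
      by (auto simp: downs_def words_def low_splits_def splits_def successively_append_iff last_above_def next_below_def)
  qed
  moreover have "{(X, Y) \<in> low_splits. \<not> last_above X \<and> last_odd X \<and> \<not> next_below Y \<and> next_even Y} = (\<Union>Z\<in>?W. ups v Z)"
  proof (intro set_eqI iffI; clarify)
    fix X Y assume *: "(X, Y) \<in> low_splits" "\<not> last_above X" "last_odd X" "\<not> next_below Y" "next_even Y"
    note e = low_splits_ends[OF *(1)]
    have l: "last X < v" "Y \<noteq> []" "v < hd Y"
      using * level_less(5)[OF e(2)] level_less(5)[OF e(3)] by (auto simp: last_above_def next_below_def)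
    have "asc_ok (last X) (hd Y)" using * l by (auto simp: asc_ok_def last_odd_def next_even_def)
    hence "X @ Y \<in> ?W" using * e
      by (auto simp: words_def low_splits_def splits_def successively_append_iff)
    thus "(X, Y) \<in> (\<Union>Z\<in>?W. ups v Z)" using l e by (auto simp: ups_def)
  next
    fix Z X Y assume "Z \<in> words asc_ok C {..<v}" "Z \<noteq> []" "(X, Y) \<in> ups v Z"
    thus "(X, Y) \<in> low_splits \<and> \<not> last_above X \<and> last_odd X \<and> \<not> next_below Y \<and> next_even Y"
      by (auto simp: ups_def words_def low_splits_def splits_def successively_append_iff
            last_above_def next_below_def last_odd_def next_even_def asc_ok_def)
  qed
  moreover have "card (\<Union>Z\<in>?W. downs v Z) = (\<Sum>Z\<in>?W. card (downs v Z))"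
    using finite_C by (intro card_UN_crossings finite_crossings) (auto simp: downs_def)
  moreover have "card (\<Union>Z\<in>?W. ups v Z) = (\<Sum>Z\<in>?W. card (ups v Z))"
    using finite_C by (intro card_UN_crossings finite_crossings) (auto simp: ups_def)
  \<comment> \<open>The correction term vanishes because \<open>Z\<close> starts below
    \<open>v\<close>.\<close>
  moreover have "card (downs v Z) = card (ups v Z)" if "Z \<in> ?W" for Z
    using that notin card_downs_eq_card_ups[of Z v] by (auto simp: words_def)
  ultimately show ?thesis by simp
qed

text \<open>With \<open>a\<close>, \<open>b\<close> for the two conditions on \<open>X\<close> and \<open>c\<close>, \<open>d\<close> for those on \<open>Y\<close>, the condition
  \<open>(a \<or> b) \<and> (c \<or> d)\<close> exceeds the union of \<open>(a \<or> b) \<and> c\<close> and \<open>a \<and> (c \<or> d)\<close> by exactly the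
  up-crossings, which are as many as the intersection \<open>a \<and> c\<close>, the down-crossings.\<close>

lemma num_factor_eq:
  "card {xs \<in> words asc_ok (insert (v + 2) (insert (v + 1) C)) {..<v}. \<exists>X Y. xs = X @ [v + 2, v + 1] @ Y} =
   num_words (insert v C) {..<v} + num_words (insert (v + 1) C) {..<v}"
proof -
  let ?N = "{(X, Y) \<in> low_splits. \<not> last_above X \<and> last_odd X \<and> \<not> next_below Y \<and> next_even Y}"
  let ?A = "{(X, Y) \<in> low_splits. (last_above X \<or> last_odd X) \<and> next_below Y}"
  let ?B = "{(X, Y) \<in> low_splits. last_above X \<and> (next_below Y \<or> next_even Y)}"
  have "finite low_splits" by (rule finite_subset[OF _ finite_splits[OF finite_C]]) (auto simp: low_splits_def)
  hence fin: "finite ?N" "finite ?A" "finite ?B" by (auto elim: rev_finite_subset)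
  have "{(X, Y) \<in> low_splits. (last_above X \<or> last_odd X) \<and> (next_below Y \<or> next_even Y)} = (?A \<union> ?B) \<union> ?N" by auto
  hence "card {(X, Y) \<in> low_splits. (last_above X \<or> last_odd X) \<and> (next_below Y \<or> next_even Y)} = card (?A \<union> ?B) + card ?N"
    using fin by (simp only:) (rule card_Un_disjoint, auto)
  also have "card ?N = card (?A \<inter> ?B)"
    unfolding num_crossings[symmetric] by (rule arg_cong[of _ _ card]) auto
  also have "card (?A \<union> ?B) + card (?A \<inter> ?B) = card ?A + card ?B"
    by (rule card_Un_Int[symmetric]) (use fin in blast)+
  finally show ?thesis using num_factor num_insert_low num_insert_mid by simp
qed

text \<open>Renaming \<open>v\<close> to \<open>v + 2\<close> affects a single pair:
  \<open>v\<close>, \<open>v + 1\<close> is a forbidden ascent, \<open>v + 2\<close>,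
  \<open>v + 1\<close> an allowed descent. So the images are exactly the words without that
  factor.\<close>

lemma swap_levels:
  "num_words (insert (v + 2) (insert (v + 1) C)) {..<v} =
   num_words (insert v (insert (v + 1) C)) {..<v} +
   card {xs \<in> words asc_ok (insert (v + 2) (insert (v + 1) C)) {..<v}. \<exists>X Y. xs = X @ [v + 2, v + 1] @ Y}"
proof -
  let ?W = "words asc_ok (insert (v + 2) (insert (v + 1) C)) {..<v}"
  let ?F = "{xs \<in> ?W. \<exists>X Y. xs = X @ [v + 2, v + 1] @ Y}"
  let ?R = "\<lambda>a b. asc_ok a b \<and> \<not> (a = v + 2 \<and> b = v + 1)"
  let ?f = "\<lambda>x. if x = v then v + 2 else x"
  let ?D = "insert v (insert (v + 1) C)"
  have "card (words ?R (?f ` ?D) {..<v}) = num_words ?D {..<v}"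
  proof (rule card_words_image)
    show "inj_on ?f ?D" using notin by (auto simp: inj_on_def)
    fix a b assume ab: "a \<in> ?D" "b \<in> ?D" "a \<noteq> b"
    have x: "asc_ok (v + 2) (v + 1)" "\<not> asc_ok v (v + 1)" "asc_ok (v + 1) v" "asc_ok (v + 1) (v + 2)"
      using even_v by (auto simp: asc_ok_def)
    show "?R (?f a) (?f b) \<longleftrightarrow> asc_ok a b"
      using ab x notin level_asc_ok[of a] level_asc_ok[of b] by auto
  qed (use notin in auto)
  moreover have "?f ` ?D = insert (v + 2) (insert (v + 1) C)" using notin by force
  moreover have "words ?R (insert (v + 2) (insert (v + 1) C)) {..<v} = ?W - ?F"
    unfolding words_def successively_avoiding_factor by auto
  moreover have "card ?W = card ?F + card (?W - ?F)"
  proof -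
    have "finite ?W" using finite_C by simp
    hence "card ?W = card (?W \<inter> ?F) + card (?W - ?F)" by (rule card_Int_Diff)
    moreover have "?W \<inter> ?F = ?F" by blast
    ultimately show ?thesis by simp
  qed
  ultimately show ?thesis by simp
qed

text \<open>Three of the terms for a leading \<open>v + 2\<close> add up, by
  \<open>swap_levels\<close> and \<open>num_factor_eq\<close>, to the count for a leading
  \<open>v\<close>. The remaining term comes from \<open>v + 2\<close>, \<open>v + 1\<close>
  followed by an even letter from \<open>v\<close> on.\<close>

lemma even_first_recurrence:
  "num_words (insert v (insert (v + 1) (insert (v + 2) C))) {v + 2} =
   num_words (insert v (insert (v + 1) (insert (v + 2) C))) {v} +
   num_words (insert v C) {j. v \<le> j \<and> even j}"
proof -
  let ?D = "insert v (insert (v + 1) C)"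
  have "num_words (insert v (insert (v + 1) (insert (v + 2) C))) {v + 2} = num_words (insert (v + 2) ?D) {v + 2}"
    by (simp add: insert_commute)
  also have "\<dots> = num_words ?D {j. asc_ok (v + 2) j}"
    using notin by (intro num_words_Cons) auto
  also have "words asc_ok ?D {j. asc_ok (v + 2) j} = words asc_ok ?D ({..<v} \<union> ({v} \<union> {v + 1}))"
    using even_v level_asc_ok by (intro words_cong) (auto simp: asc_ok_def)
  also have "card \<dots> = num_words ?D {..<v} + (num_words ?D {v} + num_words ?D {v + 1})"
    using finite_C by (subst num_words_Un, simp, simp, force)+ simp
  also have "num_words ?D {v} = num_words (insert (v + 1) C) {j. asc_ok v j}"
    using notin by (intro num_words_Cons) auto
  also have "words asc_ok (insert (v + 1) C) {j. asc_ok v j} = words asc_ok (insert (v + 1) C) {..<v}"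
    using even_v level_asc_ok by (intro words_cong) (auto simp: asc_ok_def)
  also have "num_words ?D {v + 1} = num_words (insert (v + 1) (insert v C)) {v + 1}"
    by (simp add: insert_commute)
  also have "\<dots> = num_words (insert v C) {j. asc_ok (v + 1) j}"
    using notin by (intro num_words_Cons) auto
  also have "words asc_ok (insert v C) {j. asc_ok (v + 1) j} =
      words asc_ok (insert v C) ({..<v} \<union> {j. v \<le> j \<and> even j})"
  proof (intro words_cong refl)
    have "asc_ok (v + 1) v" by (simp add: asc_ok_def)
    moreover have "asc_ok (v + 1) c \<longleftrightarrow> c < v \<or> v \<le> c \<and> even c" if "c \<in> C" for c
      using level_asc_ok(6)[OF that] by auto
    ultimately show "{j. asc_ok (v + 1) j} \<inter> insert v C = ({..<v} \<union> {j. v \<le> j \<and> even j}) \<inter> insert v C"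
      using even_v by auto
  qed
  also have "card \<dots> = num_words (insert v C) {..<v} + num_words (insert v C) {j. v \<le> j \<and> even j}"
    using finite_C by (intro num_words_Un) auto
  finally have 1: "num_words (insert v (insert (v + 1) (insert (v + 2) C))) {v + 2} =
    num_words ?D {..<v} + num_words (insert (v + 1) C) {..<v} + num_words (insert v C) {..<v} +
    num_words (insert v C) {j. v \<le> j \<and> even j}" by simp
  let ?E = "insert (v + 2) (insert (v + 1) C)"
  have "num_words (insert v (insert (v + 1) (insert (v + 2) C))) {v} = num_words (insert v ?E) {v}"
    by (simp add: insert_commute)
  also have "\<dots> = num_words ?E {j. asc_ok v j}"
    using notin by (intro num_words_Cons) auto
  also have "words asc_ok ?E {j. asc_ok v j} = words asc_ok ?E {..<v}"
    using even_v level_asc_ok by (intro words_cong) (auto simp: asc_ok_def)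
  finally show ?thesis using 1 swap_levels num_factor_eq by simp
qed

end

section \<open>The recurrence for even first letters and the Seidel triangle: part (c)\<close>

lemma num_words_even_step:
  assumes "2 \<le> k" "k \<le> n"
  shows "num_words {1..2*n} {2*k} =
    num_words {1..2*n} {2*k - 2} + num_words {1..2*n - 2} {j. 2*k - 2 \<le> j \<and> even j}"
proof -
  define v where "v = 2*k - 2"
  define C where "C = {1..2*n} - {v, v + 1, v + 2}"
  have v: "2 \<le> v" "2*k = v + 2" "v + 2 \<le> 2*n" "even v" using assms by (auto simp: v_def)
  interpret three_levels v C
    by standard (auto simp: C_def v)
  have eq: "{1..2*n} = insert v (insert (v + 1) (insert (v + 2) C))"
    using v by (auto simp: C_def)
  \<comment> \<open>Opens a gap for \<open>v + 1\<close> and \<open>v + 2\<close>; the shift by two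
    keeps order and parity.\<close>
  let ?f = "\<lambda>x. if x \<le> v then x else x + 2"
  have "insert v C = ?f ` {1..2*n - 2}"
  proof (intro equalityI subsetI)
    fix x assume x: "x \<in> insert v C"
    show "x \<in> ?f ` {1..2*n - 2}"
    proof (cases "x \<le> v")
      case True
      hence "x = ?f x" "x \<in> {1..2*n - 2}" using x v by (auto simp: C_def)
      thus ?thesis by (rule image_eqI)
    next
      case False
      hence "x = ?f (x - 2)" "x - 2 \<in> {1..2*n - 2}" using x v by (auto simp: C_def)
      thus ?thesis by (rule image_eqI)
    qed
  qed (use v in \<open>auto simp: C_def split: if_splits\<close>)
  moreover have "num_words (?f ` {1..2*n - 2}) {j. v \<le> j \<and> even j} =
      num_words {1..2*n - 2} {j. v \<le> j \<and> even j}"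
    by (rule card_words_image) (auto simp: inj_on_def asc_ok_def split: if_splits)
  ultimately show ?thesis
    using even_first_recurrence unfolding eq[symmetric] v(2) by simp
qed

text \<open>Row \<open>2*m + 1\<close> consists of the partial sums of row \<open>2*m\<close>. In
  the reversed index these sum over the even first letters from \<open>2*s\<close> on, so the
  induction runs down from \<open>s = m + 1\<close>, where both sides vanish.\<close>

lemma seidel_odd_row:
  assumes "1 \<le> m" "\<And>i. 1 \<le> i \<Longrightarrow> i \<le> m \<Longrightarrow> num_words {1..2*m} {2*i} = seidel (2*m) (m + 1 - i)"
    and "s \<le> m + 1"
  shows "seidel (2*m + 1) (m + 1 - s) = num_words {1..2*m} {j. 2*s \<le> j \<and> even j}"
  using assms(3)
proof (induction rule: inc_induct)
  case base
  have "words asc_ok {1..2*m} {j. 2*(m + 1) \<le> j \<and> even j} = words asc_ok {1..2*m} {}"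
    by (intro words_cong) auto
  also have "\<dots> = {}" using assms(1) by (auto simp: words_def)
  finally have "num_words {1..2*m} {j. 2*(m + 1) \<le> j \<and> even j} = 0" by (simp only: card.empty)
  thus ?case by (simp add: seidel.simps)
next
  case (step s)
  have s: "s \<le> m" using step by simp
  have 1: "num_words {1..2*m} {2*s} = seidel (2*m) (m + 1 - s)"
  \<comment> \<open>For \<open>s = 0\<close> the index \<open>m + 1\<close> lies just outside row
    \<open>2*m\<close>, and no word starts with 0.\<close>
  proof (cases "s = 0")
    case True
    have "words asc_ok {1..2*m} {2*s} = words asc_ok {1..2*m} {}"
      using True by (intro words_cong) auto
    also have "\<dots> = {}" using assms(1) by (auto simp: words_def)
    finally have "num_words {1..2*m} {2*s} = 0" by (simp only: card.empty)
    thus ?thesis using True by (simp add: seidel.simps)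
  qed (use assms(2) s in simp)
  have "{j. 2*s \<le> j \<and> even j} = {2*s} \<union> {j. 2*Suc s \<le> j \<and> even j}"
    by (auto elim!: evenE)
  hence "num_words {1..2*m} {j. 2*s \<le> j \<and> even j} =
      num_words {1..2*m} {2*s} + num_words {1..2*m} {j. 2*Suc s \<le> j \<and> even j}"
    using assms(1) by (simp only:) (rule num_words_Un, auto)
  also have "\<dots> = seidel (2*m) (m + 1 - s) + seidel (2*m + 1) (m + 1 - s - 1)"
    using 1 step.IH by simp
  also have "\<dots> = seidel (2*m + 1) (m + 1 - s)"
    using s assms(1) by (subst (3) seidel.simps) auto
  finally show ?case by simp
qed

text \<open>In the index \<open>n + 1 - k\<close> the recurrence of row \<open>2*n\<close> becomes
  \<open>num_words_even_step\<close>, whose sum is an entry of row \<open>2*n - 1\<close> by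
  \<open>seidel_odd_row\<close>. The outer induction is on \<open>n\<close>, the inner one on
  \<open>k\<close>.\<close>

lemma num_words_even_eq_seidel:
  assumes "1 \<le> n" "1 \<le> k" "k \<le> n"
  shows "num_words {1..2*n} {2*k} = seidel (2*n) (n + 1 - k)"
  using assms
proof (induction n arbitrary: k rule: nat_induct_at_least)
  case base
  hence "k = 1" by simp
  moreover have "num_words {1..2*1} {2} = card (words asc_ok {} {j. even j})"
    using first_one_two(2)[of 1] by simp
  moreover have "words asc_ok {} {j. even j} = {[]}" by (auto simp: words_def)
  moreover have "seidel 2 1 = 1" 
    by (simp add: seidel.simps[of 2] seidel.simps[of "Suc 0"])
  ultimately show ?case by simp
next
  case (Suc m)
  have row: "seidel (2*m + 1) (m + 1 - s) = num_words {1..2*m} {j. 2*s \<le> j \<and> even j}"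
    if "s \<le> m + 1" for s
    using seidel_odd_row[OF Suc.hyps Suc.IH that] by simp
  have rec: "seidel (2*Suc m) (Suc m + 1 - i) =
      num_words {1..2*m} {j. 2*(i - 1) \<le> j \<and> even j} + seidel (2*Suc m) (Suc m + 1 - (i - 1))"
    if "1 \<le> i" "i \<le> Suc m" for i
  proof -
    have "seidel (2*Suc m) (Suc m + 1 - i) = 
        seidel (2*m + 1) (m + 1 - (i - 1)) + seidel (2*Suc m) (Suc m + 1 - i + 1)"
      using that by (subst seidel.simps) auto
    also have "Suc m + 1 - i + 1 = Suc m + 1 - (i - 1)" using that by simp
    finally show ?thesis using row[of "i - 1"] that by simp
  qed
  from Suc.prems show ?case
  proof (induction k rule: nat_induct_at_least)
    case base
    have "num_words {1..2*Suc m} {2} = num_words {1 + 2..2*Suc m} {j. even j}"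
      using first_one_two(2)[of "Suc m"] by (simp add: numeral_3_eq_3)
    also have "\<dots> = num_words {1..2*m} {j. even j}"
      by (subst num_words_shift_two) simp_all
    \<comment> \<open>The index \<open>Suc (Suc m)\<close> is outside row \<open>2 * Suc m\<close>,
      so only the entry of the odd row remains.\<close>
    finally show ?case using rec[of 1] by (simp add: seidel.simps[of _ "Suc (Suc m)"])
  next
    case (Suc k)
    have "num_words {1..2*Suc m} {2*Suc k} =
        num_words {1..2*Suc m} {2*k} + num_words {1..2*m} {j. 2*k \<le> j \<and> even j}"
      using num_words_even_step[of "Suc k" "Suc m"] Suc by simp
    thus ?case using Suc rec[of "Suc k"] by simp
  qed
qed

theorem theorem1p5:
  shows "(\<forall>n::nat. n \<ge> 1 \<longrightarrow>
            G_I_first (2*n) 1 = G_I_first (2*n) 2 \<and>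
            2 * G_I_first (2*n) (2*n - 1) = (\<Sum>i = 1..2*n. G_I_first (2*n) i) \<and>
            (\<forall>k. 1 \<le> k \<and> k \<le> n \<longrightarrow> G_I_first (2*n) (2*k) = seidel (2*n) (n + 1 - k))) \<and>
         (\<forall>n::nat. n \<ge> 2 \<longrightarrow>
            G_I_first (2*n) 3 = 2 * (G_I_first (2*n) 1 + G_I_first (2*n - 2) 1) \<and>
            G_I_first (2*n) (2*n) = (\<Sum>i = 1..2*n - 2. G_I_first (2*n - 2) i) \<and>
            (\<Sum>i = 1..2*n - 2. G_I_first (2*n - 2) i) = G_I (2*n - 2))"
proof -
  have total: "(\<Sum>i = 1..m. G_I_first m i) = num_words {1..m} UNIV" if "1 \<le> m" for m
    using sum_G_I_first[of "{1..m}" m] that words_cong[of "{1..m}" "{1..m}" "{1..m}" UNIV asc_ok] by simp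
  show ?thesis
  proof (intro conjI allI impI)
    fix n :: nat assume n: "1 \<le> n"
    show "G_I_first (2*n) 1 = G_I_first (2*n) 2"
      using n first_one_two[of n] by (simp add: G_I_first_eq)
    show "2 * G_I_first (2*n) (2*n - 1) = (\<Sum>i = 1..2*n. G_I_first (2*n) i)"
      using n first_second_largest[of n] total[of "2*n"] G_I_first_eq[of "2*n - 1" "2*n"] by simp
    fix k assume "1 \<le> k \<and> k \<le> n"
    thus "G_I_first (2*n) (2*k) = seidel (2*n) (n + 1 - k)"
      using n num_words_even_eq_seidel[of n k] by (simp add: G_I_first_eq)
  next
    fix n :: nat assume n: "2 \<le> n"
    show "G_I_first (2*n) 3 = 2 * (G_I_first (2*n) 1 + G_I_first (2*n - 2) 1)"
      using n first_three[of n] by (simp add: G_I_first_eq)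
    show "G_I_first (2*n) (2*n) = (\<Sum>i = 1..2*n - 2. G_I_first (2*n - 2) i)"
      using n first_largest[of n] total[of "2*n - 2"] by (simp add: G_I_first_eq)
    show "(\<Sum>i = 1..2*n - 2. G_I_first (2*n - 2) i) = G_I (2*n - 2)"
      using n total[of "2*n - 2"] by (simp add: G_I_eq)
  qed
qed

end
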